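(* Let $d=1$ and let $Q$ be a probability measure on $\Omega=\{0,1\}^{\mathbb{Z}}$ satisfying the standing assumptions (i) and (ii) of the context. Then the random walk $\{X_n\}_{n\ge0}$ on the discrete point process is $\mathbb{P}$-almost surely recurrent, i.e. $\mathbb{P}(X_n=0\text{ for infinitely many }n)=1$.
   Context: Setting. $\Omega=\{0,1\}^{\mathbb{Z}^d}$ (here $d=1$) with its Borel (product) $\sigma$-algebra $\mathfrak{B}$; for $x\in\mathbb{Z}^d$ the shift $\theta_x:\Omega\to\Omega$ is $(\theta_x\omega)(y)=\omega(x+y)$; $e_1,\dots,e_d$ are the standard basis vectors and $\mathcal{E}=\{\pm e_i\}_{i=1}^d$; $\mathcal{P}(\omega)=\{x\in\mathbb{Z}^d:\omega(x)=1\}$. Standing assumptions on $Q$: (i) $Q$ is stationary (invariant) and ergodic with respect to each single shift $\theta_{e_i}$, $i=1,\dots,d$; (ii) $Q(\mathcal{P}(\omega)=\emptyset)<1$. $\Omega_0=\{\omega\in\Omega:\omega(0)=1\}$ (it has positive $Q$-measure), and $P=Q(\cdot\mid\Omega_0)$. For $e\in\mathcal{E}$, $f_e(\omega)=\min\{k>0:\omega(ke)=1\}$ (almost surely finite). For $v\in\mathbb{Z}^d$, $N_v(\omega)=\{v+f_e(\theta_v\omega)e: e\in\mathcal{E}\}$ is the set of the $2d$ coordinate nearest neighbors of $v$, one in each of the $2d$ directions. Random walk. For $P$-a.e. $\omega\in\Omega_0$, the quenched law $P_\omega$ on $(\mathbb{Z}^d)^{\mathbb{N}}$ is the law of the Markov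 chain $\{X_n\}_{n\ge0}$ on $\mathcal{P}(\omega)$ with $X_0=0$ and $P_\omega(X_{n+1}=u\mid X_n=v)=\frac1{2d}$ if $u\in N_v(\omega)$ and $0$ otherwise. The annealed law is $\mathbb{P}(\cdot)=\int_{\Omega_0}P_\omega(\cdot)\,P(d\omega)$. *)

theory Defs
  imports "HOL-Probability.Probability"
begin

(* The case d = 1. A configuration is a predicate on the integers: \<omega> x means \<omega>(x) = 1. *)

type_synonym config = "int \<Rightarrow> bool"

definition config_space :: "config measure" where
  "config_space = PiM UNIV (\<lambda>_. count_space UNIV)"

definition translate :: "int \<Rightarrow> config \<Rightarrow> config" where
  "translate x \<omega> = (\<lambda>y. \<omega> (x + y))"

definition points :: "config \<Rightarrow> int set" where
  "points \<omega> = {x. \<omega> x}"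

definition stationary :: "'a measure \<Rightarrow> ('a \<Rightarrow> 'a) \<Rightarrow> bool" where
  "stationary M T \<longleftrightarrow> T \<in> measurable M M \<and> distr M M T = M"

definition ergodic :: "'a measure \<Rightarrow> ('a \<Rightarrow> 'a) \<Rightarrow> bool" where
  "ergodic M T \<longleftrightarrow>
     (\<forall>A\<in>sets M. T -` A \<inter> space M = A \<longrightarrow> measure M A = 0 \<or> measure M A = 1)"

definition Omega0 :: "config set" where
  "Omega0 = {\<omega>. \<omega> 0}"

definition palm :: "config measure \<Rightarrow> config measure" where
  "palm Q = uniform_measure Q Omega0"

definition directions :: "int set" where
  "directions = {1, -1}"

(* If there is no point in direction e, the value is an unspecified number; under the standing
   assumptions this concerns only a null set of configurations. *)
definition gap :: "int \<Rightarrow> config \<Rightarrow> nat" where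
  "gap e \<omega> = (LEAST k. k > 0 \<and> \<omega> (int k * e))"

definition neighbors :: "config \<Rightarrow> int \<Rightarrow> int set" where
  "neighbors \<omega> v = {v + int (gap e (translate v \<omega>)) * e | e. e \<in> directions}"

lemma finite_neighbors [simp]: "finite (neighbors \<omega> v)"
  and neighbors_nonempty [simp]: "neighbors \<omega> v \<noteq> {}"
  by (auto simp: neighbors_def directions_def)

definition transition :: "config \<Rightarrow> int \<Rightarrow> int pmf" where
  "transition \<omega> v = pmf_of_set (neighbors \<omega> v)"

lemma pmf_transition:
  assumes "\<And>e. e \<in> directions \<Longrightarrow> \<exists>k>0. \<omega> (v + int k * e)"
  shows "pmf (transition \<omega> v) u = (if u \<in> neighbors \<omega> v then 1 / 2 else 0)"
proof -
  have pos: "gap e (translate v \<omega>) > 0" if "e \<in> directions" for e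
    using LeastI_ex[of "\<lambda>k. k > 0 \<and> \<omega> (v + int k * e)"] assms[OF that]
    by (simp add: gap_def translate_def)
  have "neighbors \<omega> v = {v + int (gap 1 (translate v \<omega>)), v - int (gap (-1) (translate v \<omega>))}"
    by (force simp: neighbors_def directions_def)
  moreover have "v + int (gap 1 (translate v \<omega>)) \<noteq> v - int (gap (-1) (translate v \<omega>))"
    using pos[of 1] pos[of "-1"] by (simp add: directions_def)
  ultimately have "card (neighbors \<omega> v) = 2"
    by (metis card_2_iff)
  then show ?thesis
    by (simp add: transition_def indicator_def)
qed

definition path_space :: "(nat \<Rightarrow> int) measure" where
  "path_space = PiM UNIV (\<lambda>_. count_space UNIV)"

(* The conditional law of X n given the values h of X 0, ..., X (n - 1). *)
definition walk_kernel :: "config \<Rightarrow> nat \<Rightarrow> (nat \<Rightarrow> int) \<Rightarrow> int measure" where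
  "walk_kernel \<omega> n h =
     measure_pmf (case n of 0 \<Rightarrow> return_pmf 0 | Suc m \<Rightarrow> transition \<omega> (h m))"

interpretation walk: Ionescu_Tulcea "walk_kernel \<omega>" "\<lambda>_. count_space UNIV" for \<omega> :: config
proof (rule Ionescu_Tulcea.intro)
  show "walk_kernel \<omega> i \<in>
      measurable (PiM {0..<i} (\<lambda>_. count_space UNIV)) (subprob_algebra (count_space UNIV))" for i
  proof (cases i)
    case 0
    have "measure_pmf (return_pmf (0::int)) \<in> space (subprob_algebra (count_space UNIV))"
      by (simp add: measure_pmf_in_subprob_space)
    then show ?thesis
      using 0 by (simp add: walk_kernel_def[abs_def])
  next
    case (Suc m)
    have "(\<lambda>h. h m) \<in> measurable (PiM {0..<i} (\<lambda>_. count_space UNIV)) (count_space (UNIV::int set))"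
      by (rule measurable_component_singleton) (simp add: Suc)
    moreover have "(\<lambda>v. measure_pmf (transition \<omega> v)) \<in>
        measurable (count_space UNIV) (subprob_algebra (count_space UNIV))"
      by (simp add: measure_pmf_in_subprob_space)
    ultimately show ?thesis
      using Suc by (simp add: walk_kernel_def[abs_def])
  qed
qed (unfold walk_kernel_def, rule prob_space_measure_pmf)

definition quenched :: "config \<Rightarrow> (nat \<Rightarrow> int) measure" where
  "quenched \<omega> = walk.PF.lim \<omega>"

lemma space_quenched [simp]: "space (quenched \<omega>) = UNIV"
  and sets_quenched [simp, measurable_cong]: "sets (quenched \<omega>) = sets path_space"
  by (auto simp: quenched_def path_space_def space_PiM walk.PF.sets_lim)

lemma emeasure_C_singleton:
  "emeasure (walk.C \<omega> 0 (Suc n) (\<lambda>_. undefined)) {restrict x {0..<Suc n}} =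
     (if x 0 = 0 then \<Prod>i<n. pmf (transition \<omega> (x i)) (x (Suc i)) else 0)"
proof -
  let ?M = "\<lambda>n. PiM {0..<n} (\<lambda>_. count_space (UNIV::int set))"
  let ?C = "\<lambda>n. walk.C \<omega> 0 n (\<lambda>_. undefined)"
  have sing: "{restrict x {0..<n}} \<in> sets (?M n)" for n
  proof -
    have "{restrict x {0..<n}} = PiE {0..<n} (\<lambda>i. {x i})"
      by (auto simp: PiE_iff extensional_def restrict_def fun_eq_iff)
    then show ?thesis by (simp add: sets_PiM_I_finite)
  qed
  have sp: "(\<lambda>_. undefined) \<in> space (?M 0)" by (simp add: space_PiM PiE_iff extensional_def)
  have vimage_aux: "f -` {r} = (if P then {c} else {})"
    if "\<And>y. f y = r \<longleftrightarrow> P \<and> y = c" for f :: "int \<Rightarrow> nat \<Rightarrow> int" and r P c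
    using that by auto
  have sets_C: "sets (?C n) = sets (?M n)" for n
    using walk.sets_C[OF sp, of \<omega> n] by (simp only: add_0)
  have step: "emeasure (?C (Suc n)) {restrict x {0..<Suc n}} =
      emeasure (walk_kernel \<omega> n (restrict x {0..<n})) {x n} * emeasure (?C n) {restrict x {0..<n}}" for n
  proof -
    have meas: "walk.eP \<omega> n \<in> measurable (?C n) (subprob_algebra (?M (Suc n)))"
      using walk.measurable_eP[of \<omega> n] by (simp only: measurable_cong_sets[OF sets_C refl])
    have "?C (Suc n) = ?C n \<bind> walk.eP \<omega> n"
      by simp
    then have "emeasure (?C (Suc n)) {restrict x {0..<Suc n}} =
        (\<integral>\<^sup>+h. emeasure (walk.eP \<omega> n h) {restrict x {0..<Suc n}} \<partial>?C n)"
      using emeasure_bind[OF prob_space.not_empty[OF walk.prob_space_C[OF sp]] meas sing[of "Suc n"]]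
      by (simp only:)
    also have "\<dots> = (\<integral>\<^sup>+h. emeasure (walk_kernel \<omega> n (restrict x {0..<n})) {x n} *
        indicator {restrict x {0..<n}} h \<partial>?C n)"
    proof (rule nn_integral_cong)
      fix h assume "h \<in> space (?C n)"
      then have h: "h \<in> space (?M n)"
        using sets_eq_imp_space_eq[OF sets_C] by simp
      then have ext: "h j = undefined" if "\<not> j < n" for j
        using that by (simp add: space_PiM PiE_iff extensional_def)
      have "fun_upd h n y = restrict x {0..<Suc n} \<longleftrightarrow> h = restrict x {0..<n} \<and> y = x n" for y
      proof
        assume eq: "fun_upd h n y = restrict x {0..<Suc n}"
        have "h j = restrict x {0..<n} j" for j
          using fun_cong[OF eq, of j] ext[of j] by (cases "j < n") auto
        then show "h = restrict x {0..<n} \<and> y = x n"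
          using fun_cong[OF eq, of n] by auto
      qed (auto simp: fun_eq_iff restrict_def)
      then have "(\<lambda>y. fun_upd h n y) -` {restrict x {0..<Suc n}} =
          (if h = restrict x {0..<n} then {x n} else {})"
        by (rule vimage_aux)
      then show "emeasure (walk.eP \<omega> n h) {restrict x {0..<Suc n}} =
          emeasure (walk_kernel \<omega> n (restrict x {0..<n})) {x n} * indicator {restrict x {0..<n}} h"
        unfolding walk.emeasure_eP[OF h sing] by (auto simp only: indicator_def space_count_space
            Int_UNIV_right emeasure_empty mult_1_right mult_zero_right insert_iff empty_iff
            of_bool_eq simp_thms if_True split: if_split)
    qed
    also have "\<dots> = emeasure (walk_kernel \<omega> n (restrict x {0..<n})) {x n} *
        emeasure (?C n) {restrict x {0..<n}}"
      by (intro nn_integral_cmult_indicator) (simp only: sets_C sing)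
    finally show ?thesis .
  qed
  show ?thesis
  proof (induction n)
    case 0
    have "emeasure (?C 0) {restrict x {0..<0}} = 1"
      using sing[of 0] by (simp add: restrict_def)
    moreover have "emeasure (walk_kernel \<omega> 0 (restrict x {0..<0})) {x 0} = (if x 0 = 0 then 1 else 0)"
      by (simp add: walk_kernel_def emeasure_pmf_single)
    ultimately show ?case
      by (simp only: step[of 0] lessThan_0 prod.empty mult_1_right split: if_split) simp
  next
    case (Suc n)
    have "emeasure (walk_kernel \<omega> (Suc n) (restrict x {0..<Suc n})) {x (Suc n)} =
        ennreal (pmf (transition \<omega> (x n)) (x (Suc n)))"
      by (simp add: walk_kernel_def emeasure_pmf_single)
    then show ?case
      by (simp only: step[of "Suc n"] Suc.IH)
        (simp add: ennreal_mult'[symmetric] prod_nonneg mult.commute)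
  qed
qed

lemma emeasure_quenched_cylinder:
  "emeasure (quenched \<omega>) {X. \<forall>i\<le>n. X i = x i} =
     (if x 0 = 0 then \<Prod>i<n. pmf (transition \<omega> (x i)) (x (Suc i)) else 0)"
proof -
  let ?J = "{0..<Suc n}" and ?M = "\<lambda>_. count_space (UNIV::int set)"
  have sing: "{restrict x ?J} \<in> sets (PiM ?J ?M)"
  proof -
    have "{restrict x ?J} = PiE ?J (\<lambda>i. {x i})"
      by (auto simp: PiE_iff extensional_def restrict_def fun_eq_iff)
    then show ?thesis by (simp only: sets_PiM_I_finite finite_atLeastLessThan) simp
  qed
  have "{X. \<forall>i\<le>n. X i = x i} = prod_emb UNIV ?M ?J {restrict x ?J}"
    by (auto simp: prod_emb_def restrict_def fun_eq_iff less_Suc_eq_le) metis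
  then have "emeasure (quenched \<omega>) {X. \<forall>i\<le>n. X i = x i} = emeasure (walk.CI \<omega> ?J) {restrict x ?J}"
    using walk.lim[OF _ sing] by (simp add: quenched_def)
  also have "\<dots> = emeasure (walk.C \<omega> 0 (Suc n) (\<lambda>_. undefined))
      (prod_emb ?J ?M ?J {restrict x ?J})"
    by (rule walk.emeasure_CI[OF order_refl sing])
  also have "prod_emb ?J ?M ?J {restrict x ?J} = {restrict x ?J}"
    using sets.sets_into_space[OF sing] by (intro prod_emb_id) (simp add: space_PiM)
  finally show ?thesis by (simp only: emeasure_C_singleton)
qed

lemma prob_space_quenched: "prob_space (quenched \<omega>)"
proof
  let ?M = "\<lambda>_. count_space (UNIV::int set)"
  have "space (quenched \<omega>) = prod_emb UNIV ?M {} (space (PiM {} ?M))"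
    by (auto simp: prod_emb_def space_PiM)
  then have "emeasure (quenched \<omega>) (space (quenched \<omega>)) = emeasure (walk.CI \<omega> {}) (space (PiM {} ?M))"
    using walk.lim[of "{}" "space (PiM {} ?M)" \<omega>] by (simp add: quenched_def)
  also have "\<dots> = 1"
    using prob_space.emeasure_space_1[OF walk.PF.prob_space_P[of "{}" \<omega>]]
    by (simp add: walk.CI_def)
  finally show "emeasure (quenched \<omega>) (space (quenched \<omega>)) = 1" .
qed

definition cylinders :: "(nat \<Rightarrow> int) set set" where
  "cylinders = insert {} {{X. \<forall>i\<le>n. X i = x i} | n x. True}"

lemma Int_stable_cylinders: "Int_stable cylinders"
proof -
  have le: "{X. \<forall>i\<le>n. X i = x i} \<inter> {X. \<forall>i\<le>m. X i = y i} \<in> cylinders"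
    if "n \<le> m" for n m and x y :: "nat \<Rightarrow> int"
  proof (cases "\<forall>i\<le>n. x i = y i")
    case True
    then have "{X. \<forall>i\<le>n. X i = x i} \<inter> {X. \<forall>i\<le>m. X i = y i} = {X. \<forall>i\<le>m. X i = y i}"
      using that by auto
    then show ?thesis unfolding cylinders_def by blast
  next
    case False
    then have "{X. \<forall>i\<le>n. X i = x i} \<inter> {X. \<forall>i\<le>m. X i = y i} = {}"
      using that by (auto dest: order_trans)
    then show ?thesis by (simp add: cylinders_def)
  qed
  have "{X. \<forall>i\<le>n. X i = x i} \<inter> {X. \<forall>i\<le>m. X i = y i} \<in> cylinders"
    for n m and x y :: "nat \<Rightarrow> int"
    using le[of n m x y] le[of m n y x] by (cases "n \<le> m") (simp_all add: Int_commute)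
  note * = this
  have cases: "A = {} \<or> (\<exists>n x. A = {X. \<forall>i\<le>n. X i = x i})" if "A \<in> cylinders" for A
    using that unfolding cylinders_def by blast
  have "A \<inter> B \<in> cylinders" if AB: "A \<in> cylinders" "B \<in> cylinders" for A B
  proof (cases "A = {} \<or> B = {}")
    case True
    then show ?thesis by (auto simp: cylinders_def)
  next
    case False
    then obtain n x m y where "A = {X. \<forall>i\<le>n. X i = x i}" "B = {X. \<forall>i\<le>m. X i = y i}"
      using cases[OF AB(1)] cases[OF AB(2)] by blast
    then show ?thesis by (simp only: *)
  qed
  then show ?thesis by (simp add: Int_stable_def)
qed

lemma sets_path_space: "sets path_space = sigma_sets UNIV cylinders"
proof
  have "{X. \<forall>i\<le>n. X i = x i} \<in> sets path_space" for n and x :: "nat \<Rightarrow> int"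
  proof -
    have "{X \<in> space path_space. \<forall>i\<in>{..n}. X i = x i} \<in> sets path_space"
      unfolding path_space_def by measurable
    then show ?thesis by (simp add: path_space_def space_PiM Ball_def)
  qed
  then have "cylinders \<subseteq> sets path_space" by (auto simp: cylinders_def)
  moreover have "space path_space = UNIV" by (simp add: path_space_def space_PiM)
  ultimately show "sigma_sets UNIV cylinders \<subseteq> sets path_space"
    using sets.sigma_sets_subset[of cylinders path_space] by simp
next
  have gen: "sets path_space = sigma_sets UNIV {{X. X i \<in> A} | i A. True}"
    by (simp add: path_space_def sets_PiM_single PiE_UNIV_domain)
  have "{X. X i \<in> A} \<in> sigma_sets UNIV cylinders" for i and A :: "int set"
  proof -
    let ?L = "{l::int list. length l = Suc i \<and> l ! i \<in> A}"
    have "{X. X i \<in> A} = (\<Union>l\<in>?L. {X. \<forall>j\<le>i. X j = l ! j})"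
    proof (intro set_eqI iffI)
      fix X :: "nat \<Rightarrow> int" assume "X \<in> {X. X i \<in> A}"
      then show "X \<in> (\<Union>l\<in>?L. {X. \<forall>j\<le>i. X j = l ! j})"
        by (intro UN_I[of "map X [0..<Suc i]"]) (auto simp del: upt_Suc)
    qed auto
    moreover have "\<dots> \<in> sigma_sets UNIV cylinders"
    proof (rule sigma_sets_UNION)
      show "countable ((\<lambda>l. {X. \<forall>j\<le>i. X j = l ! j}) ` ?L)" by (rule countableI_type[THEN countable_image])
      show "B \<in> sigma_sets UNIV cylinders" if "B \<in> (\<lambda>l. {X. \<forall>j\<le>i. X j = l ! j}) ` ?L" for B
        using that by (intro sigma_sets.Basic) (auto simp: cylinders_def)
    qed
    ultimately show ?thesis by simp
  qed
  then show "sets path_space \<subseteq> sigma_sets UNIV cylinders"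
    unfolding gen by (intro sigma_sets_mono) auto
qed

lemma measurable_pmf_transition [measurable]:
  "(\<lambda>\<omega>. pmf (transition \<omega> v) u) \<in> borel_measurable config_space"
proof -
  have [measurable]: "(\<lambda>\<omega>. gap e (translate v \<omega>)) \<in> measurable config_space (count_space UNIV)" for e
    unfolding gap_def translate_def config_space_def by measurable
  have "transition \<omega> v =
      pmf_of_set {v + int (gap 1 (translate v \<omega>)), v - int (gap (-1) (translate v \<omega>))}" for \<omega>
    unfolding transition_def
    by (rule arg_cong[where f=pmf_of_set]) (force simp: neighbors_def directions_def)
  moreover have "(\<lambda>\<omega>. (\<lambda>(a, b). pmf (pmf_of_set {v + int a, v - int b}) u)
      (gap 1 (translate v \<omega>), gap (-1) (translate v \<omega>))) \<in> borel_measurable config_space"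
    by (rule measurable_compose[where N="count_space UNIV"])
      (auto simp: pair_measure_countable[symmetric] simp del: UNIV_Times_UNIV simp: UNIV_Times_UNIV[symmetric])
  ultimately show ?thesis by simp
qed

lemma measurable_quenched [measurable]:
  "quenched \<in> measurable config_space (prob_algebra path_space)"
proof (rule measurable_prob_algebra_generated[OF sets_path_space Int_stable_cylinders])
  fix A assume "A \<in> cylinders"
  then show "(\<lambda>\<omega>. emeasure (quenched \<omega>) A) \<in> borel_measurable config_space"
    by (auto simp: cylinders_def emeasure_quenched_cylinder)
qed (auto simp: prob_space_quenched)

definition annealed :: "config measure \<Rightarrow> (nat \<Rightarrow> int) measure" where
  "annealed Q = palm Q \<bind> quenched"

lemma sets_annealed [simp]:
  assumes "sets Q = sets config_space"
  shows "sets (annealed Q) = sets path_space"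
proof -
  have "space Q = UNIV"
    using sets_eq_imp_space_eq[OF assms] by (simp add: config_space_def space_PiM)
  then show ?thesis
    unfolding annealed_def palm_def by (intro sets_bind) auto
qed

lemma emeasure_annealed:
  assumes "sets Q = sets config_space" and "A \<in> sets path_space"
  shows "emeasure (annealed Q) A = (\<integral>\<^sup>+\<omega>. emeasure (quenched \<omega>) A \<partial>palm Q)"
proof -
  have "space Q = UNIV"
    using sets_eq_imp_space_eq[OF assms(1)] by (simp add: config_space_def space_PiM)
  moreover have "sets (palm Q) = sets config_space"
    by (simp add: palm_def assms(1))
  then have "quenched \<in> measurable (palm Q) (subprob_algebra path_space)"
    using measurable_prob_algebraD[OF measurable_quenched] by (simp cong: measurable_cong_sets)
  ultimately show ?thesis
    unfolding annealed_def using assms(2) by (intro emeasure_bind) (auto simp: palm_def)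
qed

end

theory Submission
  imports Defs
begin

text \<open>By stationarity the probability of having no point beyond \<open>n\<close> in a given direction does not
  depend on \<open>n\<close>; letting \<open>n\<close> tend to both infinities and using ergodicity, almost every
  configuration has points arbitrarily far in both directions. For such a configuration the
  probability of never visiting \<open>0\<close> at a positive time, as a function of the starting point and set
  to \<open>0\<close> at the origin, is bounded and harmonic on the points other than \<open>0\<close>, hence affine on each
  half-line of points, hence zero. By the Markov property no time can be the last visit to \<open>0\<close>.\<close>

section \<open>Points in both directions\<close>

text \<open>For \<open>e\<close> equal to 1 or -1 the order of \<open>e * y\<close> is the order
  along direction \<open>e\<close>. This convention runs through the whole proof and treats both
  half-lines at once.\<close>

definition unbounded_toward :: "int \<Rightarrow> config \<Rightarrow> bool" where
  "unbounded_toward e \<omega> \<longleftrightarrow> (\<forall>n. \<exists>y. n \<le> e * y \<and> \<omega> y)"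

definition empty_beyond :: "int \<Rightarrow> int \<Rightarrow> config set" where
  "empty_beyond e n = {\<omega>. \<forall>y. n \<le> e * y \<longrightarrow> \<not> \<omega> y}"

lemma space_config_space [simp]: "space config_space = UNIV"
  by (simp add: config_space_def space_PiM)

lemma measurable_point [measurable]: "Measurable.pred config_space (\<lambda>\<omega>. \<omega> x)"
  unfolding config_space_def by measurable

lemma sets_empty_beyond [measurable]: "empty_beyond e n \<in> sets config_space"
proof -
  have "{\<omega> \<in> space config_space. \<forall>y. n \<le> e * y \<longrightarrow> \<not> \<omega> y} \<in> sets config_space"
    by measurable
  then show ?thesis by (simp add: empty_beyond_def)
qed

lemma sets_unbounded_toward [measurable]: "{\<omega>. unbounded_toward e \<omega>} \<in> sets config_space"
proof -
  have "{\<omega> \<in> space config_space. \<forall>n. \<exists>y. n \<le> e * y \<and> \<omega> y} \<in> sets config_space"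
    by measurable
  then show ?thesis by (simp add: unbounded_toward_def)
qed

lemma vimage_translate_empty_beyond:
  "translate 1 -` empty_beyond e n = empty_beyond e (n + e)"
proof -
  have "(\<forall>y. n \<le> e * y \<longrightarrow> \<not> \<omega> (1 + y)) \<longleftrightarrow> (\<forall>y. n + e \<le> e * y \<longrightarrow> \<not> \<omega> y)" for \<omega> :: config
  proof safe
    fix y assume "\<forall>y. n \<le> e * y \<longrightarrow> \<not> \<omega> (1 + y)" "n + e \<le> e * y" "\<omega> y"
    then show False by (auto simp: algebra_simps dest!: spec[of _ "y - 1"])
  next
    fix y assume "\<forall>y. n + e \<le> e * y \<longrightarrow> \<not> \<omega> y" "n \<le> e * y" "\<omega> (1 + y)"
    then show False by (auto simp: algebra_simps dest!: spec[of _ "1 + y"])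
  qed
  then show ?thesis by (simp add: empty_beyond_def translate_def)
qed

lemma measure_empty_beyond:
  assumes "sets Q = sets config_space" "stationary Q (translate 1)" "e \<in> directions"
  shows "measure Q (empty_beyond e n) = measure Q (empty_beyond e 0)"
proof -
  have sp: "space Q = UNIV"
    using sets_eq_imp_space_eq[OF assms(1)] by simp
  have shift: "measure Q (empty_beyond e (n + e)) = measure Q (empty_beyond e n)" for n
  proof -
    have "measure Q (empty_beyond e n) = measure (distr Q Q (translate 1)) (empty_beyond e n)"
      using assms(2) by (simp add: stationary_def)
    also have "\<dots> = measure Q (translate 1 -` empty_beyond e n \<inter> space Q)"
      using assms(1,2) by (intro measure_distr) (auto simp: stationary_def)
    finally show ?thesis
      by (simp add: sp vimage_translate_empty_beyond)
  qed
  \<comment> \<open>For \<open>e = 1\<close> this is the shift identity at \<open>n\<close>; for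
    \<open>e = -1\<close> it is the one at \<open>n + 1\<close>, read backwards.\<close>
  have succ: "measure Q (empty_beyond e (n + 1)) = measure Q (empty_beyond e n)" for n
    using shift[of n] shift[of "n + 1"] assms(3) by (auto simp: directions_def)
  show ?thesis
  proof (induction n rule: int_induct[where k = 0])
    case (step2 i)
    then show ?case using succ[of "i - 1"] by simp
  qed (simp_all add: succ)
qed

lemma AE_unbounded_toward:
  assumes "prob_space Q" "sets Q = sets config_space"
    and "stationary Q (translate 1)" "ergodic Q (translate 1)"
    and "measure Q {\<omega> \<in> space Q. points \<omega> = {}} < 1" and e: "e \<in> directions"
  shows "AE \<omega> in Q. unbounded_toward e \<omega>"
proof -
  interpret prob_space Q by fact
  note [measurable_cong] = assms(2)
  have sp: "space Q = UNIV"
    using sets_eq_imp_space_eq[OF assms(2)] by simp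
  let ?A = "{\<omega>. unbounded_toward e \<omega>}"
  have const: "prob (empty_beyond e n) = prob (empty_beyond e 0)" for n
    by (rule measure_empty_beyond[OF assms(2,3) e])
  \<comment> \<open>The events grow with the threshold. A constant sequence equals its limit, so the
    union has the common probability \<open>prob (empty_beyond e 0)\<close>.\<close>
  have "(\<lambda>k. prob (empty_beyond e (int k))) \<longlonglongrightarrow> prob (\<Union>k. empty_beyond e (int k))"
    by (intro finite_Lim_measure_incseq)
      (use sets_empty_beyond assms(2) in \<open>auto simp: incseq_def empty_beyond_def\<close>)
  moreover have "(\<Union>k. empty_beyond e (int k)) = - ?A"
  proof -
    have "\<exists>k. \<forall>y. int k \<le> e * y \<longrightarrow> \<not> \<omega> y" if "\<forall>y. n \<le> e * y \<longrightarrow> \<not> \<omega> y" for n and \<omega> :: config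
      using that by (intro exI[of _ "nat n"]) simp
    then show ?thesis
      unfolding empty_beyond_def unbounded_toward_def by (simp add: set_eq_iff) blast
  qed
  ultimately have up: "prob (- ?A) = prob (empty_beyond e 0)"
    by (simp add: const[of "int k" for k] LIMSEQ_const_iff)
  \<comment> \<open>Towards minus infinity the events shrink to the absence of all points. Hence
    being bounded in direction \<open>e\<close> is exactly as likely as being empty, which is less
    than 1.\<close>
  have "(\<lambda>k. prob (empty_beyond e (- int k))) \<longlonglongrightarrow> prob (\<Inter>k. empty_beyond e (- int k))"
    by (intro finite_Lim_measure_decseq)
      (use sets_empty_beyond assms(2) in \<open>auto simp: decseq_def empty_beyond_def\<close>)
  moreover have "(\<Inter>k. empty_beyond e (- int k)) = {\<omega>. points \<omega> = {}}"
  proof -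
    have "\<exists>k. - int k \<le> e * y" for y
      by (rule exI[of _ "nat (- (e * y))"]) simp
    then show ?thesis
      unfolding empty_beyond_def points_def by (simp add: set_eq_iff) blast
  qed
  ultimately have "prob (empty_beyond e 0) = prob {\<omega>. points \<omega> = {}}"
    by (simp add: const[of "- int k" for k] LIMSEQ_const_iff)
  with up assms(5) have "prob (- ?A) < 1"
    by (simp add: sp)
  moreover have A: "?A \<in> sets Q" by measurable
  ultimately have "prob ?A \<noteq> 0"
    using prob_compl[OF A] by (simp add: sp Compl_eq_Diff_UNIV)
  \<comment> \<open>Ergodicity asks for strict invariance, not invariance up to null sets. It holds
    because translating only reindexes the union over all integers \<open>n\<close>.\<close>
  moreover have "translate 1 -` ?A \<inter> space Q = ?A"
  proof -
    have "(- ?A) = (\<Union>n. empty_beyond e n)"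
      by (auto simp: empty_beyond_def unbounded_toward_def)
    moreover have "translate 1 -` (\<Union>n. empty_beyond e n) = (\<Union>n. empty_beyond e n)"
    proof -
      have "(\<Union>n. empty_beyond e (n + e)) = (\<Union>n. empty_beyond e n)"
      proof (intro set_eqI iffI)
        fix \<omega> assume "\<omega> \<in> (\<Union>n. empty_beyond e n)"
        then obtain n where "\<omega> \<in> empty_beyond e ((n - e) + e)" by auto
        then show "\<omega> \<in> (\<Union>n. empty_beyond e (n + e))" by (rule UN_I[OF UNIV_I])
      qed auto
      then show ?thesis by (simp only: vimage_UN vimage_translate_empty_beyond)
    qed
    ultimately have "translate 1 -` (- ?A) = - ?A"
      by (simp only:)
    then show ?thesis
      unfolding vimage_Compl by (simp add: sp)
  qed
  ultimately have "prob ?A = 1"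
    using assms(4)[unfolded ergodic_def, rule_format, OF A] by simp
  then show ?thesis
    using AE_prob_1[of ?A] by simp
qed

text \<open>If the origin were almost surely vacant, stationarity would make every site almost
  surely vacant, and countably many null sets would leave no points at all. Positivity makes
  \<open>palm Q\<close> a genuine conditional law.\<close>

lemma prob_Omega0_pos:
  assumes "prob_space Q" "sets Q = sets config_space" "stationary Q (translate 1)"
    and "measure Q {\<omega> \<in> space Q. points \<omega> = {}} < 1"
  shows "measure Q Omega0 > 0"
proof (rule ccontr)
  interpret prob_space Q by fact
  note [measurable_cong] = assms(2)
  have sp: "space Q = UNIV"
    using sets_eq_imp_space_eq[OF assms(2)] by simp
  let ?B = "\<lambda>x. {\<omega>::config. \<omega> x}"
  have B: "?B x \<in> sets Q" for x
    using predE[OF measurable_point[of x]] by (simp add: assms(2))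
  have shift: "prob (?B (x + 1)) = prob (?B x)" for x
  proof -
    have "prob (?B x) = measure (distr Q Q (translate 1)) (?B x)"
      using assms(3) by (simp add: stationary_def)
    also have "\<dots> = prob (translate 1 -` ?B x \<inter> space Q)"
      using assms(3) B by (intro measure_distr) (auto simp: stationary_def)
    finally show ?thesis by (simp add: sp translate_def add.commute)
  qed
  assume "\<not> measure Q Omega0 > 0"
  then have zero: "prob (?B 0) = 0"
    by (simp add: Omega0_def zero_less_measure_iff)
  have null: "prob (?B x) = 0" for x
  proof (induction x rule: int_induct[where k = 0])
    case (step2 i)
    then show ?case using shift[of "i - 1"] by simp
  qed (simp_all add: shift zero)
  have "?B x \<in> null_sets Q" for x
    using null B by (simp add: null_sets_def emeasure_eq_measure)
  then have "AE \<omega> in Q. \<forall>x. \<omega> \<notin> ?B x"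
    unfolding AE_all_countable by (intro allI AE_not_in)
  then have "AE \<omega> in Q. points \<omega> = {}"
    by (simp add: points_def)
  moreover have "{\<omega> \<in> space Q. points \<omega> = {}} \<in> sets Q"
    unfolding points_def Collect_empty_eq by measurable
  ultimately have "prob {\<omega> \<in> space Q. points \<omega> = {}} = 1"
    by (simp add: prob_Collect_eq_1)
  with assms(4) show False by simp
qed

section \<open>Neighbouring points\<close>

text \<open>The successor map along direction \<open>e\<close>. On configurations unbounded toward
  \<open>e\<close> its iterates enumerate the points beyond \<open>v\<close>.\<close>

definition adjacent :: "int \<Rightarrow> config \<Rightarrow> int \<Rightarrow> int" where
  "adjacent e \<omega> v = v + int (gap e (translate v \<omega>)) * e"

lemma neighbors_eq_adjacent: "neighbors \<omega> v = {adjacent 1 \<omega> v, adjacent (-1) \<omega> v}"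
  by (force simp: neighbors_def directions_def adjacent_def)

context
  fixes \<omega> :: config and e :: int
  assumes e: "e \<in> directions" and unbounded: "unbounded_toward e \<omega>"
begin

lemma
  shows gap_pos: "gap e (translate v \<omega>) > 0"
    and adjacent_point: "\<omega> (adjacent e \<omega> v)"
proof -
  have ee: "e * e = 1" using e by (auto simp: directions_def)
  obtain y where y: "e * v + 1 \<le> e * y" "\<omega> y"
    using unbounded unfolding unbounded_toward_def by blast
  \<comment> \<open>The distance from \<open>v\<close> to \<open>y\<close> along \<open>e\<close>:
    as \<open>e * e = 1\<close>, stepping \<open>?k\<close> times by \<open>e\<close> from
    \<open>v\<close> reaches \<open>y\<close>, so the least number in \<open>gap\<close>
    exists.\<close>
  let ?k = "nat (e * (y - v))"
  have "v + int ?k * e = v + (e * e) * (y - v)"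
    using y by (simp add: algebra_simps)
  then have "?k > 0 \<and> \<omega> (v + int ?k * e)"
    using y ee by (simp add: algebra_simps)
  then have "gap e (translate v \<omega>) > 0 \<and> \<omega> (v + int (gap e (translate v \<omega>)) * e)"
    unfolding gap_def translate_def by (rule LeastI)
  then show "gap e (translate v \<omega>) > 0" "\<omega> (adjacent e \<omega> v)"
    by (simp_all add: adjacent_def)
qed

lemma adjacent_greater: "e * v < e * adjacent e \<omega> v"
proof -
  have "e * adjacent e \<omega> v = e * v + int (gap e (translate v \<omega>)) * (e * e)"
    by (simp add: adjacent_def algebra_simps)
  moreover have "e * e = 1" using e by (auto simp: directions_def)
  ultimately show ?thesis using gap_pos[of v] by simp
qed

lemma adjacent_adjacent:
  assumes "\<omega> v"
  shows "adjacent (- e) \<omega> (adjacent e \<omega> v) = v"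
proof -
  let ?g = "gap e (translate v \<omega>)" and ?w = "adjacent e \<omega> v"
  have "gap (- e) (translate ?w \<omega>) = ?g"
    unfolding gap_def[of "- e"]
  proof (rule Least_equality)
    show "?g > 0 \<and> translate ?w \<omega> (int ?g * - e)"
      using gap_pos assms by (simp add: adjacent_def translate_def)
  next
    fix k assume k: "k > 0 \<and> translate ?w \<omega> (int k * - e)"
    show "?g \<le> k"
    \<comment> \<open>A point met earlier on the way back would lie strictly between
      \<open>v\<close> and \<open>?w\<close>, at distance \<open>?g - k\<close> from
      \<open>v\<close>, against the minimality of \<open>?g\<close>.\<close>
    proof (rule ccontr)
      assume "\<not> ?g \<le> k"
      then have "?w + int k * - e = v + int (?g - k) * e"
        by (simp add: adjacent_def of_nat_diff algebra_simps)
      then have "?g - k > 0 \<and> translate v \<omega> (int (?g - k) * e)"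
        using k \<open>\<not> ?g \<le> k\<close> by (simp add: translate_def)
      then have "?g \<le> ?g - k"
        unfolding gap_def by (rule Least_le)
      with k \<open>\<not> ?g \<le> k\<close> show False by linarith
    qed
  qed
  then show ?thesis by (simp add: adjacent_def)
qed

text \<open>Minimality of the gap forbids jumping over a point. Applied with \<open>u = 0\<close>,
  it keeps a step towards the origin from passing the origin.\<close>

lemma adjacent_le:
  assumes "\<omega> u" "e * v < e * u"
  shows "e * adjacent e \<omega> v \<le> e * u"
proof -
  have ee: "e * e = 1" using e by (auto simp: directions_def)
  let ?k = "nat (e * (u - v))"
  have "v + int ?k * e = v + (e * e) * (u - v)"
    using assms by (simp add: algebra_simps)
  then have "?k > 0 \<and> translate v \<omega> (int ?k * e)"
    using assms ee by (simp add: algebra_simps translate_def)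
  then have "gap e (translate v \<omega>) \<le> ?k"
    unfolding gap_def by (rule Least_le)
  moreover have "e * adjacent e \<omega> v = e * v + int (gap e (translate v \<omega>)) * (e * e)"
    by (simp add: adjacent_def algebra_simps)
  ultimately show ?thesis
    using assms ee by (simp add: algebra_simps)
qed

end

section \<open>Bounded harmonic functions\<close>

lemma directions_minus: "e \<in> directions \<Longrightarrow> - e \<in> directions"
  by (auto simp: directions_def)

lemma bounded_arithmetic_progression:
  fixes f :: "nat \<Rightarrow> real"
  assumes "\<And>k. \<bar>f k\<bar> \<le> C" and "\<And>k. f (Suc (Suc k)) - f (Suc k) = f (Suc k) - f k"
  shows "f 1 = f 0"
proof -
  have diff: "f (Suc k) - f k = f 1 - f 0" for k
    by (induction k) (simp_all add: assms(2))
  have f: "f k = f 0 + real k * (f 1 - f 0)" for k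
  proof (induction k)
    case (Suc k)
    then show ?case using diff[of k] by (simp add: algebra_simps)
  qed simp
  have "\<bar>f 1 - f 0\<bar> \<le> 0"
  proof (rule ccontr)
    assume "\<not> \<bar>f 1 - f 0\<bar> \<le> 0"
    \<comment> \<open>Two values bounded by \<open>C\<close> differ by at most \<open>2 * C\<close>,
      whereas a nonzero slope eventually carries \<open>f k\<close> farther than that from
      \<open>f 0\<close>.\<close>
    then obtain k :: nat where "real k * \<bar>f 1 - f 0\<bar> > 2 * C"
      using reals_Archimedean3[of "\<bar>f 1 - f 0\<bar>"] by auto
    moreover have "real k * \<bar>f 1 - f 0\<bar> = \<bar>f k - f 0\<bar>"
      by (subst f) (simp add: abs_mult)
    ultimately show False using assms(1)[of k] assms(1)[of 0] by linarith
  qed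
  then show ?thesis by simp
qed

lemma bounded_harmonic_half_line:
  fixes h :: "int \<Rightarrow> real"
  assumes e: "e \<in> directions" and unb: "\<And>e. e \<in> directions \<Longrightarrow> unbounded_toward e \<omega>"
    and "\<omega> 0" and h0: "h 0 = 0" and bdd: "\<And>v. \<bar>h v\<bar> \<le> C"
    and harm: "\<And>v. \<omega> v \<Longrightarrow> v \<noteq> 0 \<Longrightarrow> 2 * h v = h (adjacent e \<omega> v) + h (adjacent (- e) \<omega> v)"
    and "\<omega> v" "0 \<le> e * v"
  shows "h v = 0"
proof -
  note e' = directions_minus[OF e]
  note unb_e = unb[OF e] and unb_e' = unb[OF e']
  \<comment> \<open>Harmonicity equates consecutive increments along the points \<open>x k\<close>.
    It is applied only at \<open>x (Suc k)\<close>, which lies strictly beyond the origin, so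
    \<open>u = 0\<close> is a legitimate start.\<close>
  have flat: "h (adjacent e \<omega> u) = h u" if u: "\<omega> u" "0 \<le> e * u" for u
  proof -
    define x where "x k = (adjacent e \<omega> ^^ k) u" for k
    have x: "\<omega> (x k) \<and> 0 \<le> e * x k" for k
    proof (induction k)
      case (Suc k)
      then show ?case
        using adjacent_point[OF e unb_e] adjacent_greater[OF e unb_e, of "x k"]
        by (auto simp: x_def)
    qed (simp add: x_def u)
    have "h (x (Suc (Suc k))) - h (x (Suc k)) = h (x (Suc k)) - h (x k)" for k
    proof -
      have "0 < e * x (Suc k)"
        using x[of k] adjacent_greater[OF e unb_e, of "x k"] by (simp add: x_def)
      then have "x (Suc k) \<noteq> 0" by auto
      moreover have "adjacent e \<omega> (x (Suc k)) = x (Suc (Suc k))"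
        by (simp add: x_def)
      moreover have "adjacent (- e) \<omega> (x (Suc k)) = x k"
        using adjacent_adjacent[OF e unb_e, of "x k"] x[of k] by (simp add: x_def)
      ultimately show ?thesis using harm[of "x (Suc k)"] x[of "Suc k"] by simp
    qed
    then have "h (x 1) = h (x 0)"
      by (intro bounded_arithmetic_progression[of "\<lambda>k. h (x k)" C] bdd)
    then show ?thesis by (simp add: x_def)
  qed
  \<comment> \<open>Induction on the distance to the origin: the neighbour towards 0 is closer,
    stays on the same side because 0 is a point, and carries the same value by
    \<open>flat\<close>.\<close>
  show ?thesis
    using \<open>\<omega> v\<close> \<open>0 \<le> e * v\<close>
  proof (induction "nat (e * v)" arbitrary: v rule: less_induct)
    case less
    show ?case
    proof (cases "v = 0")
      case False
      then have pos: "0 < e * v"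
        using less.prems e by (auto simp: directions_def)
      let ?u = "adjacent (- e) \<omega> v"
      have u: "\<omega> ?u" "e * ?u < e * v" "0 \<le> e * ?u"
        using adjacent_point[OF e' unb_e'] adjacent_greater[OF e' unb_e', of v]
          adjacent_le[OF e' unb_e' \<open>\<omega> 0\<close>, of v] pos by simp_all
      have "h v = h ?u"
        using flat[OF u(1,3)] adjacent_adjacent[OF e' unb_e' less.prems(1)] by simp
      also have "\<dots> = 0"
        using u pos by (intro less.hyps) auto
      finally show ?thesis .
    qed (simp add: h0)
  qed
qed

section \<open>Avoiding the origin\<close>

text \<open>The probability that the walk started at \<open>v\<close> is nonzero at times 1 to
  \<open>n\<close>. Time 0 is not tested, so \<open>v = 0\<close> gives the non-return probability.
  Dividing by \<open>card\<close> makes the recursion the mean under \<open>transition\<close> for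
  every configuration.\<close>

fun avoid :: "config \<Rightarrow> nat \<Rightarrow> int \<Rightarrow> real" where
  "avoid \<omega> 0 v = 1"
| "avoid \<omega> (Suc n) v =
     (\<Sum>u\<in>neighbors \<omega> v. if u = 0 then 0 else avoid \<omega> n u) / card (neighbors \<omega> v)"

lemma avoid_nonneg: "0 \<le> avoid \<omega> n v"
  by (induction n arbitrary: v) (auto intro!: divide_nonneg_nonneg sum_nonneg)

lemma avoid_Suc_le: "avoid \<omega> (Suc n) v \<le> avoid \<omega> n v"
proof (induction n arbitrary: v)
  case 0
  have "(\<Sum>u\<in>neighbors \<omega> v. if u = 0 then 0 else 1::real) \<le> (\<Sum>u\<in>neighbors \<omega> v. 1)"
    by (intro sum_mono) auto
  then show ?case by (simp add: divide_le_eq card_gt_0_iff cong: sum.cong if_cong)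
next
  case (Suc n)
  then show ?case
    unfolding avoid.simps(2)[of _ "Suc n"] avoid.simps(2)[of _ n v]
    by (intro divide_right_mono sum_mono) auto
qed

lemma avoid_le_1: "avoid \<omega> n v \<le> 1"
  by (induction n) (auto intro: order_trans[OF avoid_Suc_le] simp del: avoid.simps(2))

text \<open>Monotonicity in \<open>n\<close> gives a limit, and passing to the limit in the
  recursion makes it harmonic once its value at the origin is replaced by 0.\<close>

lemma avoid_tendsto_0:
  assumes unb: "\<And>e. e \<in> directions \<Longrightarrow> unbounded_toward e \<omega>" and "\<omega> 0"
  shows "(\<lambda>n. avoid \<omega> n v) \<longlonglongrightarrow> 0"
proof -
  have dirs: "1 \<in> directions" "-1 \<in> directions" by (simp_all add: directions_def)
  have "convergent (\<lambda>n. avoid \<omega> n v)" for v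
    by (intro Bseq_monoseq_convergent decseq_imp_monoseq decseq_SucI avoid_Suc_le BseqI'[of _ 1])
      (simp add: avoid_nonneg avoid_le_1)
  then obtain L where L: "\<And>v. (\<lambda>n. avoid \<omega> n v) \<longlonglongrightarrow> L v"
    unfolding convergent_def by metis
  \<comment> \<open>\<open>L 0\<close> is the non-return probability and is not known to vanish yet.
    The recursion counts a step onto 0 as failure, so \<open>L v\<close> is the average of
    \<open>h\<close>, not of \<open>L\<close>, over the neighbours.\<close>
  define h where "h v = (if v = 0 then 0 else L v)" for v
  have card2: "card (neighbors \<omega> v) = 2" "adjacent 1 \<omega> v \<noteq> adjacent (-1) \<omega> v" for v
    using adjacent_greater[OF dirs(1) unb[OF dirs(1)], of v]
      adjacent_greater[OF dirs(2) unb[OF dirs(2)], of v]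
    by (auto simp: neighbors_eq_adjacent)
  have step: "2 * L v = h (adjacent 1 \<omega> v) + h (adjacent (-1) \<omega> v)" for v
  proof -
    have "(\<lambda>n. avoid \<omega> (Suc n) v) \<longlonglongrightarrow> (\<Sum>u\<in>neighbors \<omega> v. h u) / card (neighbors \<omega> v)"
      unfolding avoid.simps h_def by (intro tendsto_intros) (auto intro: L)
    then have "L v = (\<Sum>u\<in>neighbors \<omega> v. h u) / card (neighbors \<omega> v)"
      by (rule LIMSEQ_unique[OF LIMSEQ_Suc[OF L]])
    then show ?thesis
      using card2[of v] by (simp add: neighbors_eq_adjacent)
  qed
  have "0 \<le> L v" "L v \<le> 1" for v
    by (rule LIMSEQ_le_const[OF L], simp add: avoid_nonneg)
      (rule LIMSEQ_le_const2[OF L], simp add: avoid_le_1)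
  then have bdd: "\<bar>h v\<bar> \<le> 1" for v
    by (simp add: h_def)
  have harm: "2 * h v = h (adjacent e \<omega> v) + h (adjacent (- e) \<omega> v)"
    if "v \<noteq> 0" "e \<in> directions" for v e
    using that step[of v] by (auto simp: h_def directions_def)
  have h: "h v = 0" if "\<omega> v" for v
  proof -
    obtain e where "e \<in> directions" "0 \<le> e * v"
    proof (cases "0 \<le> v")
      case True
      then show ?thesis using that[of 1] dirs by simp
    next
      case False
      then show ?thesis using that[of "-1"] dirs by simp
    qed
    then show ?thesis
      using bounded_harmonic_half_line[of e \<omega> h 1 v] unb \<open>\<omega> 0\<close> bdd harm that
      by (simp add: h_def)
  qed
  \<comment> \<open>Here \<open>v\<close> may be 0 or a vacant site. Both its neighbours are points,
    where \<open>h\<close> vanishes, so their average \<open>L v\<close> vanishes too.\<close>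
  have "L v = 0"
    using step[of v] h adjacent_point[OF dirs(1) unb[OF dirs(1)]]
      adjacent_point[OF dirs(2) unb[OF dirs(2)]] by simp
  then show ?thesis using L[of v] by simp
qed

section \<open>Recurrence\<close>

lemma measurable_path [measurable]: "(\<lambda>X. X i) \<in> measurable path_space (count_space UNIV)"
  unfolding path_space_def by measurable

lemma space_path_space [simp]: "space path_space = UNIV"
  by (simp add: path_space_def space_PiM)

lemma sets_path_space_Collect:
  "Measurable.pred path_space P \<Longrightarrow> {X. P X} \<in> sets path_space"
  by (drule predE) simp

text \<open>The Markov property for avoidance: given the history up to time \<open>m\<close>, only
  its last value \<open>x m\<close> matters. The induction extends the history by one step, so
  \<open>m\<close> and \<open>x\<close> must vary.\<close>

lemma emeasure_cylinder_avoid: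
  "emeasure (quenched \<omega>) {X. (\<forall>i\<le>m. X i = x i) \<and> (\<forall>j. m < j \<and> j \<le> m + n \<longrightarrow> X j \<noteq> 0)} =
     emeasure (quenched \<omega>) {X. \<forall>i\<le>m. X i = x i} * ennreal (avoid \<omega> n (x m))"
proof (induction n arbitrary: m x)
  case 0
  have "{X. (\<forall>i\<le>m. X i = x i) \<and> (\<forall>j. m < j \<and> j \<le> m + 0 \<longrightarrow> X j \<noteq> 0)} = {X. \<forall>i\<le>m. X i = x i}"
    by auto
  then show ?case by (simp only:) simp
next
  case (Suc n)
  let ?c = "emeasure (quenched \<omega>) {X. \<forall>i\<le>m. X i = x i}"
  let ?E = "\<lambda>u. {X. (\<forall>i\<le>Suc m. X i = (x(Suc m := u)) i) \<and>
    (\<forall>j. Suc m < j \<and> j \<le> Suc m + n \<longrightarrow> X j \<noteq> 0)}"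
  \<comment> \<open>The event is split by the value \<open>u\<close> of \<open>X (Suc m)\<close>;
    the piece for \<open>u = 0\<close> is empty because that step already hits the origin.\<close>
  let ?F = "\<lambda>u. if u = 0 then {} else ?E u"
  have upd: "(\<forall>i\<le>Suc m. X i = (x(Suc m := u)) i) \<longleftrightarrow> (\<forall>i\<le>m. X i = x i) \<and> X (Suc m) = u"
    for X :: "nat \<Rightarrow> int" and u
    by (auto simp: le_Suc_eq)
  have split: "(\<forall>j. m < j \<and> j \<le> m + Suc n \<longrightarrow> X j \<noteq> 0) \<longleftrightarrow>
      X (Suc m) \<noteq> 0 \<and> (\<forall>j. Suc m < j \<and> j \<le> Suc m + n \<longrightarrow> X j \<noteq> 0)" for X :: "nat \<Rightarrow> int"
  proof -
    have "m < j \<and> j \<le> m + Suc n \<longleftrightarrow> j = Suc m \<or> Suc m < j \<and> j \<le> Suc m + n" for j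
      by arith
    then show ?thesis by (simp only: imp_disjL all_conj_distrib simp_thms all_simps)
  qed
  have un: "{X. (\<forall>i\<le>m. X i = x i) \<and> (\<forall>j. m < j \<and> j \<le> m + Suc n \<longrightarrow> X j \<noteq> 0)} = (\<Union>u. ?F u)"
    unfolding upd split by (auto split: if_splits)
  have E: "?E u \<in> sets path_space" for u
    by (rule sets_path_space_Collect) measurable
  have disj: "disjoint_family ?F"
    unfolding disjoint_family_on_def upd by (auto split: if_splits)
  have cyl: "emeasure (quenched \<omega>) {X. \<forall>i\<le>Suc m. X i = (x(Suc m := u)) i} =
      ?c * ennreal (pmf (transition \<omega> (x m)) u)" for u
    by (simp add: emeasure_quenched_cylinder ennreal_mult'[symmetric] prod_nonneg)
  have "emeasure (quenched \<omega>) (\<Union>u. ?F u) =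
      (\<integral>\<^sup>+u. emeasure (quenched \<omega>) (?F u) \<partial>count_space UNIV)"
    by (rule emeasure_UN_countable) (use E disj in auto)
  also have "\<dots> = (\<integral>\<^sup>+u. ?c * (ennreal (pmf (transition \<omega> (x m)) u) *
      ennreal (if u = 0 then 0 else avoid \<omega> n u)) \<partial>count_space UNIV)"
  proof (rule nn_integral_cong)
    fix u
    have "emeasure (quenched \<omega>) (?E u) =
        ?c * ennreal (pmf (transition \<omega> (x m)) u) * ennreal (avoid \<omega> n u)"
      by (simp only: Suc.IH cyl) simp
    then show "emeasure (quenched \<omega>) (?F u) = ?c * (ennreal (pmf (transition \<omega> (x m)) u) *
        ennreal (if u = 0 then 0 else avoid \<omega> n u))"
      by (simp only: mult.assoc split: if_split) simp
  qed
  also have "\<dots> = ?c * (\<integral>\<^sup>+u. ennreal (pmf (transition \<omega> (x m)) u) *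
      ennreal (if u = 0 then 0 else avoid \<omega> n u) \<partial>count_space UNIV)"
    by (rule nn_integral_cmult) simp
  also have "(\<integral>\<^sup>+u. ennreal (pmf (transition \<omega> (x m)) u) *
      ennreal (if u = 0 then 0 else avoid \<omega> n u) \<partial>count_space UNIV) =
      (\<integral>\<^sup>+u. ennreal (if u = 0 then 0 else avoid \<omega> n u) \<partial>measure_pmf (transition \<omega> (x m)))"
    by (rule nn_integral_measure_pmf[symmetric])
  also have "\<dots> = ennreal (avoid \<omega> (Suc n) (x m))"
    unfolding transition_def avoid.simps
    by (subst nn_integral_pmf_of_set)
      (auto simp: sum_ennreal avoid_nonneg divide_ennreal sum_nonneg card_gt_0_iff
        ennreal_of_nat_eq_real_of_nat)
  finally show ?case by (simp only: un)
qed

lemma quenched_recurrent: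
  assumes "\<And>e. e \<in> directions \<Longrightarrow> unbounded_toward e \<omega>" and "\<omega> 0"
  shows "emeasure (quenched \<omega>) {X. \<exists>\<^sub>\<infinity>n. X n = 0} = 1"
proof -
  interpret prob_space "quenched \<omega>" by (rule prob_space_quenched)
  \<comment> \<open>A path with finitely many zeros lies in such an event, with its own history as
    \<open>x\<close>. The value \<open>x m\<close> is arbitrary, which is why \<open>avoid\<close>
    was shown to decay from every integer.\<close>
  let ?D = "\<lambda>m x. {X. (\<forall>i\<le>m. X i = x i) \<and> (\<forall>j>m. X j \<noteq> 0)} :: (nat \<Rightarrow> int) set"
  have D: "?D m x \<in> sets path_space" for m x
    by (rule sets_path_space_Collect) measurable
  have null: "?D m x \<in> null_sets (quenched \<omega>)" for m x
  proof -
    have "emeasure (quenched \<omega>) (?D m x) \<le> ennreal (avoid \<omega> n (x m))" for n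
    proof -
      let ?E = "{X. (\<forall>i\<le>m. X i = x i) \<and> (\<forall>j. m < j \<and> j \<le> m + n \<longrightarrow> X j \<noteq> 0)}"
      have "?E \<in> sets path_space"
        by (rule sets_path_space_Collect) measurable
      then have "emeasure (quenched \<omega>) (?D m x) \<le> emeasure (quenched \<omega>) ?E"
        by (intro emeasure_mono) auto
      also have "\<dots> \<le> 1 * ennreal (avoid \<omega> n (x m))"
        unfolding emeasure_cylinder_avoid by (intro mult_right_mono emeasure_le_1) auto
      finally show ?thesis by simp
    qed
    moreover have "(\<lambda>n. ennreal (avoid \<omega> n (x m))) \<longlonglongrightarrow> 0"
      using tendsto_ennrealI[OF avoid_tendsto_0[OF assms]] by simp
    ultimately have "emeasure (quenched \<omega>) (?D m x) \<le> 0"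
      by (intro LIMSEQ_le_const) auto
    then show ?thesis using D by (simp add: null_sets_def)
  qed
  \<comment> \<open>Histories are coded by integer lists, of which there are countably many, so that
    the null events can be united; functions on all times would be uncountably many.\<close>
  have "AE X in quenched \<omega>. \<forall>m. \<forall>l::int list. X \<notin> ?D m ((!) l)"
    unfolding AE_all_countable by (intro allI AE_not_in null)
  then have "AE X in quenched \<omega>. \<exists>\<^sub>\<infinity>n. X n = 0"
  proof (rule AE_mp, intro AE_I2 impI)
    fix X assume X: "\<forall>m. \<forall>l::int list. X \<notin> ?D m ((!) l)"
    have "\<exists>j>m. X j = 0" for m
    proof -
      \<comment> \<open>The list has length \<open>Suc m\<close>, so it records \<open>X\<close> at
        all times up to and including \<open>m\<close>.\<close>
      have "\<forall>i\<le>m. X i = map X [0..<Suc m] ! i"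
        by (simp del: upt_Suc)
      moreover have "X \<notin> ?D m ((!) (map X [0..<Suc m]))"
        by (rule X[rule_format])
      ultimately show ?thesis by (simp del: upt_Suc)
    qed
    then show "\<exists>\<^sub>\<infinity>n. X n = 0" by (simp add: INFM_nat)
  qed
  moreover have "{X. \<exists>\<^sub>\<infinity>n. X n = 0} \<in> sets path_space"
    unfolding INFM_nat by (rule sets_path_space_Collect) measurable
  ultimately show ?thesis
    using emeasure_eq_1_AE[of "{X. \<exists>\<^sub>\<infinity>n. X n = 0}"] by simp
qed

theorem proposition1p6:
  fixes Q :: "config measure"
  assumes "prob_space Q"
    and "sets Q = sets config_space"
    and "stationary Q (translate 1)"
    and "ergodic Q (translate 1)"
    and "measure Q {\<omega> \<in> space Q. points \<omega> = {}} < 1"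
  shows "measure (annealed Q) {X \<in> space (annealed Q). \<exists>\<^sub>\<infinity>n. X n = 0} = 1"
proof -
  interpret prob_space Q by fact
  have sp: "space Q = UNIV"
    using sets_eq_imp_space_eq[OF assms(2)] by simp
  have O: "Omega0 \<in> sets Q"
    using predE[OF measurable_point[of 0]] by (simp add: Omega0_def assms(2))
  have pos: "emeasure Q Omega0 \<noteq> 0"
    using prob_Omega0_pos[OF assms(1,2,3,5)] by (simp add: emeasure_eq_measure)
  interpret palm: prob_space "palm Q"
    unfolding palm_def by (rule prob_space_uniform_measure[OF pos]) simp
  let ?R = "{X::nat \<Rightarrow> int. \<exists>\<^sub>\<infinity>n. X n = 0}"
  have R: "?R \<in> sets path_space"
    unfolding INFM_nat by (rule sets_path_space_Collect) measurable
  have "AE \<omega> in Q. \<forall>e\<in>directions. unbounded_toward e \<omega>"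
    using AE_unbounded_toward[OF assms] by (simp add: directions_def)
  \<comment> \<open>Conditioning on \<open>Omega0\<close> preserves almost sure properties of
    \<open>Q\<close> and adds that the origin is a point, as \<open>quenched_recurrent\<close>
    requires.\<close>
  then have "AE \<omega> in palm Q. (\<forall>e\<in>directions. unbounded_toward e \<omega>) \<and> \<omega> 0"
    unfolding palm_def using O pos
    by (intro AE_uniform_measureI) (auto simp: Omega0_def)
  then have "AE \<omega> in palm Q. emeasure (quenched \<omega>) ?R = 1"
    by (rule AE_mp) (auto intro!: AE_I2 quenched_recurrent)
  then have "(\<integral>\<^sup>+\<omega>. emeasure (quenched \<omega>) ?R \<partial>palm Q) = (\<integral>\<^sup>+\<omega>. 1 \<partial>palm Q)"
    by (rule nn_integral_cong_AE)
  then have "emeasure (annealed Q) ?R = 1"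
    by (simp add: emeasure_annealed[OF assms(2) R] palm.emeasure_space_1)
  moreover have "space (annealed Q) = UNIV"
    using sets_eq_imp_space_eq[OF sets_annealed[OF assms(2)]] by simp
  ultimately show ?thesis by (simp add: measure_def)
qed

end
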